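(* Assume that there exist $\mathbf{w}_k=[w_{k,1},\ldots,w_{k,F}]^T$ such that the cost-to-go satisfies $\bar c_k(\mathbf{x}_k)=-\mathbf{w}_k^T\mathbf{h}(\mathbf{x}_k)$, where $\mathbf{h}(\mathbf{x}_k)=[h_1(\mathbf{x}_k),\ldots,h_F(\mathbf{x}_k)]^T$ and $h_i:\mathcal{X}\to\mathbb{R}$, $i=1,\dots,F$, are known functions. Let $\hat\Delta=\{(\hat{\mathbf{x}}_0,\hat{\mathbf{u}}_1),\ldots,(\hat{\mathbf{x}}_{M-1},\hat{\mathbf{u}}_M)\}$ be a sequence of data with $\hat{\mathbf{x}}_k\sim p^{(x)}_{k\mid k-1}$ and $\hat{\mathbf{u}}_k\sim{p^{(u)}_{k\mid k-1}}^{\ast}$, where $${p^{(u)}_{k\mid k-1}}^{\ast}=\frac{\bar p^{(u)}_{k\mid k-1}\exp\big(-\mathbb{E}_{p^{(x)}_{k\mid k-1}}[\bar c_k(\mathbf{X}_k)]\big)}{\sum_{\mathbf{u}_k}\bar p^{(u)}_{k\mid k-1}\exp\big(-\mathbb{E}_{p^{(x)}_{k\mid k-1}}[\bar c_k(\mathbf{X}_k)]\big)},\qquad \bar p^{(u)}_{k\mid k-1}:=q^{(u)}_{k\mid k-1}\exp\big(-\mathcal{D}_{\mathrm{KL}}(p^{(x)}_{k\mid k-1}\,\|\,q^{(x)}_{k\mid k-1})\big).$$ Then the maximum likelihood estimate for $\bar c_k(\mathbf{x}_k)$, say $\bar c^{\ast}_k(\mathbf{x}_k)$, is given by $\bar c^{\ast}_k(\mathbf{x}_k)=-{\mathbf{w}^{\ast}_k}^T\mathbf{h}(\mathbf{x}_k)$,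 where $\mathbf{w}^{\ast}=[\mathbf{w}_1^{\ast T},\ldots,\mathbf{w}_M^{\ast T}]^T$ is obtained by solving the following optimization problem, which is convex: $$\mathbf{w}^{\ast}\in\arg\min_{\mathbf{w}}\ \sum_{k=1}^M\Big(-\mathbb{E}_{p(\mathbf{x}_k\mid\hat{\mathbf{x}}_{k-1},\hat{\mathbf{u}}_k)}[\mathbf{w}_k^T\mathbf{h}(\mathbf{x}_k)]+\ln\Big(\sum_{\mathbf{u}_k}\bar q^{(u)}_{k\mid k-1}(\hat{\mathbf{x}}_{k-1},\mathbf{u}_k)\exp\big(\mathbb{E}_{p(\mathbf{x}_k\mid\hat{\mathbf{x}}_{k-1},\mathbf{u}_k)}[\mathbf{w}_k^T\mathbf{h}(\mathbf{x}_k)]\big)\Big)\Big),$$ with $$\bar q^{(u)}_{k\mid k-1}(\hat{\mathbf{x}}_{k-1},\mathbf{u}_k):=q(\mathbf{u}_k\mid\hat{\mathbf{x}}_{k-1})\exp\big(-\mathcal{D}_{\mathrm{KL}}(p(\mathbf{x}_k\mid\hat{\mathbf{x}}_{k-1},\mathbf{u}_k)\,\|\,q(\mathbf{x}_k\mid\hat{\mathbf{x}}_{k-1},\mathbf{u}_k))\big).$$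
   Context: $\mathcal{X}\subseteq\mathbb{Z}^n$ and $\mathcal{U}\subseteq\mathbb{Z}^p$ are the state and input sets. For each $k$, $p^{(x)}_{k\mid k-1}=p^{(x)}_k(\mathbf{x}_k\mid\mathbf{u}_k,\mathbf{x}_{k-1})$, also written $p(\mathbf{x}_k\mid\mathbf{x}_{k-1},\mathbf{u}_k)$, is the (known) conditional probability mass function (pmf) of the next state; $q^{(x)}_{k\mid k-1}=q^{(x)}_k(\mathbf{x}_k\mid\mathbf{u}_k,\mathbf{x}_{k-1})$, also written $q(\mathbf{x}_k\mid\mathbf{x}_{k-1},\mathbf{u}_k)$, and $q^{(u)}_{k\mid k-1}=q^{(u)}_k(\mathbf{u}_k\mid\mathbf{x}_{k-1})$, also written $q(\mathbf{u}_k\mid\mathbf{x}_{k-1})$, are given (known) conditional pmfs. $\mathcal{D}_{\mathrm{KL}}(p\,\|\,q)=\sum_{\mathbf{v}}p(\mathbf{v})\ln(p(\mathbf{v})/q(\mathbf{v}))$ (sum over $\mathbf{x}_k$ for state-transition pmfs) and $\mathbb{E}_{p^{(x)}_{k\mid k-1}}$ is expectation over $\mathbf{x}_k$ given $(\mathbf{x}_{k-1},\mathbf{u}_k)$. All sums involving pmfs are assumed to exist. The cost-to-go $\bar c_k:\mathcal{X}\to\mathbb{R}$ is obtained from the agent's stage costs $c_k:\mathcal{X}\to\mathbb{R}$, over a horizon $1,\dots,N$, by the backward recursion $\bar c_k=c_k-\hat c_k$, $\hat c_N\equiv 0$, and for $k<N$ $$\hat c_k(\mathbf{x}_k)=\ln\Big(\mathbb{E}_{q^{(u)}_{k+1\mid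 k}}\big[\exp\big(-\mathcal{D}_{\mathrm{KL}}(p^{(x)}_{k+1\mid k}\,\|\,q^{(x)}_{k+1\mid k})-\mathbb{E}_{p^{(x)}_{k+1\mid k}}[\bar c_{k+1}(\mathbf{X}_{k+1})]\big)\big]\Big).$$ The policy ${p^{(u)}_{k\mid k-1}}^{\ast}$ in the claim is the optimal policy of the problem of minimizing, over policies $\{p^{(u)}_{k\mid k-1}\}$, $\mathcal{D}_{\mathrm{KL}}(p_{0:N}\,\|\,q_{0:N})+\sum_{k=1}^N\mathbb{E}[c_k(\mathbf{X}_k)]$, with $p_{0:N}=p_0(\mathbf{x}_0)\prod_{k}p^{(x)}_{k\mid k-1}p^{(u)}_{k\mid k-1}$ and $q_{0:N}=q_0(\mathbf{x}_0)\prod_k q^{(x)}_{k\mid k-1}q^{(u)}_{k\mid k-1}$; the optimal cost of this problem is assumed bounded (standing assumption). The times $k=1,\dots,M$ are those for which this policy is defined. Maximum likelihood: the unknown parameter is $\mathbf{w}=[\mathbf{w}_1^T,\ldots,\mathbf{w}_M^T]^T$, $\mathbf{w}_k\in\mathbb{R}^F$ (unconstrained), and the likelihood of $\hat\Delta$ is the probability of the observed data, $p_0(\hat{\mathbf{x}}_0)\prod_{k=1}^{M-1}p^{(x)}_k(\hat{\mathbf{x}}_k\mid\hat{\mathbf{u}}_k,\hat{\mathbf{x}}_{k-1})\prod_{k=1}^{M}{p^{(u)}_{k\mid k-1}}^{\ast}(\hat{\mathbf{u}}_k\mid\hat{\mathbf{x}}_{k-1})$, where the policy is evaluated with $\bar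 c_k=-\mathbf{w}_k^T\mathbf{h}$; a maximum likelihood estimate is obtained from a maximizer over $\mathbf{w}$. *)

theory Defs
  imports "HOL-Probability.Probability"
begin

text \<open>
  Relative entropy of two mass functions on a carrier, with the usual conventions:
  \<open>0 ln (0 / b) = 0\<close>, and the value is infinite if \<open>f\<close> is not absolutely continuous with
  respect to \<open>g\<close>.  For probability mass functions the negative part of the series always
  converges, so failure of summability also means that the value is infinite.
\<close>

definition KL :: "'a set \<Rightarrow> ('a \<Rightarrow> real) \<Rightarrow> ('a \<Rightarrow> real) \<Rightarrow> ereal" where
  "KL S f g =
    (if (\<forall>v\<in>S. g v = 0 \<longrightarrow> f v = 0) \<and> (\<lambda>v. f v * ln (f v / g v)) summable_on S
     then ereal (\<Sum>\<^sub>\<infinity>v\<in>S. f v * ln (f v / g v)) else \<infinity>)"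

text \<open>\<open>exp (- d)\<close> for \<open>d > - \<infinity>\<close>, with \<open>exp (- \<infinity>) = 0\<close>.\<close>

definition exp_neg :: "ereal \<Rightarrow> real" where
  "exp_neg d = (if d = \<infinity> then 0 else exp (- real_of_ereal d))"

text \<open>
  In \<open>trans_p m k u x\<close> and \<open>trans_q m k u x\<close> the arguments \<open>u\<close> and \<open>x\<close> are the input at
  time \<open>k\<close> and the state at time \<open>k - 1\<close>; in \<open>input_q m k x\<close> and in policies, \<open>x\<close> is the
  state at time \<open>k - 1\<close>.
\<close>

record ('x, 'u) control_problem =
  States :: "'x set"
  Inputs :: "'u set"
  init_p :: "'x pmf"
  init_q :: "'x pmf"
  trans_p :: "nat \<Rightarrow> 'u \<Rightarrow> 'x \<Rightarrow> 'x pmf"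
  trans_q :: "nat \<Rightarrow> 'u \<Rightarrow> 'x \<Rightarrow> 'x pmf"
  input_q :: "nat \<Rightarrow> 'x \<Rightarrow> 'u pmf"
  stage_cost :: "nat \<Rightarrow> 'x \<Rightarrow> real"
  horizon :: nat

definition wf_problem :: "('x, 'u) control_problem \<Rightarrow> bool" where
  "wf_problem m \<longleftrightarrow>
     set_pmf (init_p m) \<subseteq> States m \<and> set_pmf (init_q m) \<subseteq> States m \<and>
     (\<forall>k\<in>{1..horizon m}. \<forall>x\<in>States m.
        set_pmf (input_q m k x) \<subseteq> Inputs m \<and>
        (\<forall>u\<in>Inputs m. set_pmf (trans_p m k u x) \<subseteq> States m \<and>
                      set_pmf (trans_q m k u x) \<subseteq> States m))"

definition trans_KL :: "('x, 'u) control_problem \<Rightarrow> nat \<Rightarrow> 'u \<Rightarrow> 'x \<Rightarrow> ereal" where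
  "trans_KL m k u x = KL (States m) (pmf (trans_p m k u x)) (pmf (trans_q m k u x))"

definition next_exp ::
    "('x, 'u) control_problem \<Rightarrow> nat \<Rightarrow> 'x \<Rightarrow> 'u \<Rightarrow> ('x \<Rightarrow> real) \<Rightarrow> real" where
  "next_exp m k x u f = measure_pmf.expectation (trans_p m k u x) f"

text \<open>
  The functions \<open>c-hat\<close> and \<open>c-bar\<close> of the backward recursion; \<open>c-bar\<close> at time \<open>k + 1\<close> is
  spelled out inside the recursion as stage cost minus \<open>c-hat\<close>.
\<close>

function c_hat :: "('x, 'u) control_problem \<Rightarrow> nat \<Rightarrow> 'x \<Rightarrow> real" where
  "c_hat m k x =
    (if k < horizon m then
       ln (measure_pmf.expectation (input_q m (Suc k) x)
         (\<lambda>u. exp_neg (trans_KL m (Suc k) u x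
            + ereal (next_exp m (Suc k) x u
                (\<lambda>y. stage_cost m (Suc k) y - c_hat m (Suc k) y)))))
     else 0)"
  by pat_completeness auto
termination by (relation "Wellfounded.measure (\<lambda>(m, k, x). horizon m - k)") auto

declare c_hat.simps [simp del]

definition c_bar :: "('x, 'u) control_problem \<Rightarrow> nat \<Rightarrow> 'x \<Rightarrow> real" where
  "c_bar m k x = stage_cost m k x - c_hat m k x"

text \<open>
  The recursion produces genuine real-valued functions: all expectations exist and every
  argument of the logarithm is positive.
\<close>

definition recursion_exists :: "('x, 'u) control_problem \<Rightarrow> bool" where
  "recursion_exists m \<longleftrightarrow>
     (\<forall>k\<in>{1..horizon m}. \<forall>x\<in>States m. \<forall>u\<in>Inputs m.
        integrable (measure_pmf (trans_p m k u x)) (c_bar m k)) \<and>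
     (\<forall>k\<in>{1..<horizon m}. \<forall>x\<in>States m.
        let g = (\<lambda>u. exp_neg (trans_KL m (Suc k) u x
                       + ereal (next_exp m (Suc k) x u (c_bar m (Suc k)))))
        in integrable (measure_pmf (input_q m (Suc k) x)) g \<and>
           measure_pmf.expectation (input_q m (Suc k) x) g > 0)"

text \<open>
  The control problem.  A trajectory is a pair of a state sequence, indexed by \<open>0..N\<close>, and an
  input sequence, indexed by \<open>1..N\<close>.  Policies range over those for which the expected stage
  costs exist.
\<close>

type_synonym ('x, 'u) policy = "nat \<Rightarrow> 'x \<Rightarrow> 'u pmf"

definition trajectories :: "('x, 'u) control_problem \<Rightarrow> ((nat \<Rightarrow> 'x) \<times> (nat \<Rightarrow> 'u)) set" where
  "trajectories m =
     (\<Pi>\<^sub>E k\<in>{0..horizon m}. States m) \<times> (\<Pi>\<^sub>E k\<in>{1..horizon m}. Inputs m)"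

definition traj_mass ::
    "nat \<Rightarrow> 'x pmf \<Rightarrow> (nat \<Rightarrow> 'u \<Rightarrow> 'x \<Rightarrow> 'x pmf) \<Rightarrow> ('x, 'u) policy \<Rightarrow>
     (nat \<Rightarrow> 'x) \<times> (nat \<Rightarrow> 'u) \<Rightarrow> real" where
  "traj_mass N r0 rx ru = (\<lambda>(xs, us). pmf r0 (xs 0) *
     (\<Prod>k=1..N. pmf (rx k (us k) (xs (k - 1))) (xs k) * pmf (ru k (xs (k - 1))) (us k)))"

definition p_mass ::
    "('x, 'u) control_problem \<Rightarrow> ('x, 'u) policy \<Rightarrow> (nat \<Rightarrow> 'x) \<times> (nat \<Rightarrow> 'u) \<Rightarrow> real" where
  "p_mass m pu = traj_mass (horizon m) (init_p m) (trans_p m) pu"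

definition q_mass ::
    "('x, 'u) control_problem \<Rightarrow> (nat \<Rightarrow> 'x) \<times> (nat \<Rightarrow> 'u) \<Rightarrow> real" where
  "q_mass m = traj_mass (horizon m) (init_q m) (trans_q m) (input_q m)"

definition admissible_policy :: "('x, 'u) control_problem \<Rightarrow> ('x, 'u) policy \<Rightarrow> bool" where
  "admissible_policy m pu \<longleftrightarrow>
     (\<forall>k\<in>{1..horizon m}. \<forall>x\<in>States m. set_pmf (pu k x) \<subseteq> Inputs m) \<and>
     (\<forall>k\<in>{1..horizon m}.
        (\<lambda>\<tau>. p_mass m pu \<tau> * stage_cost m k (fst \<tau> k)) summable_on trajectories m)"

definition total_cost :: "('x, 'u) control_problem \<Rightarrow> ('x, 'u) policy \<Rightarrow> ereal" where
  "total_cost m pu = KL (trajectories m) (p_mass m pu) (q_mass m)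
     + ereal (\<Sum>k=1..horizon m.
         \<Sum>\<^sub>\<infinity>\<tau>\<in>trajectories m. p_mass m pu \<tau> * stage_cost m k (fst \<tau> k))"

definition optimal_policy :: "('x, 'u) control_problem \<Rightarrow> ('x, 'u) policy \<Rightarrow> bool" where
  "optimal_policy m pu \<longleftrightarrow> is_arg_min (total_cost m) (admissible_policy m) pu"

text \<open>
  \<open>p_bar\<close> is the weight called both \<open>p-bar\<close> (in the policy) and \<open>q-bar\<close> (in the objective);
  \<open>policy_formula m k f x u\<close> is the closed-form policy for the cost-to-go \<open>f\<close> at time \<open>k\<close>.
\<close>

definition p_bar :: "('x, 'u) control_problem \<Rightarrow> nat \<Rightarrow> 'x \<Rightarrow> 'u \<Rightarrow> real" where
  "p_bar m k x u = pmf (input_q m k x) u * exp_neg (trans_KL m k u x)"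

definition policy_formula ::
    "('x, 'u) control_problem \<Rightarrow> nat \<Rightarrow> ('x \<Rightarrow> real) \<Rightarrow> 'x \<Rightarrow> 'u \<Rightarrow> real" where
  "policy_formula m k f x u =
     p_bar m k x u * exp (- next_exp m k x u f) /
     (\<Sum>\<^sub>\<infinity>v\<in>Inputs m. p_bar m k x v * exp (- next_exp m k x v f))"

text \<open>
  The stacked parameter is \<open>w :: real ^ 'f ^ 'm\<close> with \<open>M = CARD('m)\<close> blocks in \<open>real ^ 'f\<close>;
  \<open>slot\<close> is an enumeration of the block positions by \<open>1..M\<close>, so block \<open>k\<close> is \<open>w $ slot k\<close>.
\<close>

definition likelihood ::
    "('x, 'u) control_problem \<Rightarrow> ('x \<Rightarrow> real ^ 'f) \<Rightarrow> nat \<Rightarrow> (nat \<Rightarrow> 'm::finite) \<Rightarrow>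
     (nat \<Rightarrow> 'x) \<Rightarrow> (nat \<Rightarrow> 'u) \<Rightarrow> real ^ 'f ^ 'm \<Rightarrow> real" where
  "likelihood m h M slot xd ud w =
     pmf (init_p m) (xd 0) *
     (\<Prod>k=1..M - 1. pmf (trans_p m k (ud k) (xd (k - 1))) (xd k)) *
     (\<Prod>k=1..M. policy_formula m k (\<lambda>x. - (w $ slot k \<bullet> h x)) (xd (k - 1)) (ud k))"

definition max_likelihood_estimate ::
    "('x, 'u) control_problem \<Rightarrow> ('x \<Rightarrow> real ^ 'f) \<Rightarrow> nat \<Rightarrow> (nat \<Rightarrow> 'm::finite) \<Rightarrow>
     (nat \<Rightarrow> 'x) \<Rightarrow> (nat \<Rightarrow> 'u) \<Rightarrow> (nat \<Rightarrow> 'x \<Rightarrow> real) \<Rightarrow> bool" where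
  "max_likelihood_estimate m h M slot xd ud c \<longleftrightarrow>
     (\<exists>w. is_arg_max (likelihood m h M slot xd ud) (\<lambda>_. True) w \<and>
          (\<forall>k\<in>{1..M}. \<forall>x\<in>States m. c k x = - (w $ slot k \<bullet> h x)))"

definition objective ::
    "('x, 'u) control_problem \<Rightarrow> ('x \<Rightarrow> real ^ 'f) \<Rightarrow> nat \<Rightarrow> (nat \<Rightarrow> 'm::finite) \<Rightarrow>
     (nat \<Rightarrow> 'x) \<Rightarrow> (nat \<Rightarrow> 'u) \<Rightarrow> real ^ 'f ^ 'm \<Rightarrow> real" where
  "objective m h M slot xd ud w =
     (\<Sum>k=1..M.
        - next_exp m k (xd (k - 1)) (ud k) (\<lambda>x. w $ slot k \<bullet> h x)
        + ln (\<Sum>\<^sub>\<infinity>u\<in>Inputs m. p_bar m k (xd (k - 1)) u *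
                exp (next_exp m k (xd (k - 1)) u (\<lambda>x. w $ slot k \<bullet> h x))))"

end

theory Submission
  imports Defs
begin

text \<open>
  Up to a positive factor that does not depend on \<open>w\<close>, the likelihood is \<open>exp (- objective w)\<close>:
  a visited input has positive policy probability, hence positive weight \<open>p_bar\<close>, so all factors
  are positive.  In the objective, the expectations are linear in \<open>w\<close>, and what remains are
  log-sum-exp functions, which are convex by the weighted inequality of arithmetic and geometric
  means, applied to the normalised summands.
\<close>

lemma infsum_pos:
  fixes f :: "'a \<Rightarrow> real"
  assumes "f summable_on S" and "\<And>u. u \<in> S \<Longrightarrow> f u \<ge> 0" and "u \<in> S" and "f u > 0"
  shows "(\<Sum>\<^sub>\<infinity>u\<in>S. f u) > 0"
proof -
  have "f u = (\<Sum>\<^sub>\<infinity>v\<in>{u}. f v)"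
    by simp
  also have "\<dots> \<le> (\<Sum>\<^sub>\<infinity>v\<in>S. f v)"
    using assms by (intro infsum_mono_neutral) auto
  finally show ?thesis
    using assms(4) by linarith
qed

lemma linear_imp_convex_on:
  fixes f :: "'a::real_vector \<Rightarrow> real"
  assumes "linear f" and "convex T"
  shows "convex_on T f"
  using assms by (intro convex_onI) (auto simp: linear_add linear_scale)

text \<open>A Hoelder-type inequality for series. The index \<open>u0\<close> of positive weight
  makes every sum positive, so \<open>ln\<close> is only taken of positive numbers; summability
  keeps the sums from falling back to the default value 0.\<close>

lemma convex_on_ln_infsum_exp:
  fixes a :: "'u \<Rightarrow> real" and L :: "'u \<Rightarrow> 'v::real_vector \<Rightarrow> real"
  assumes a: "\<And>u. u \<in> S \<Longrightarrow> a u \<ge> 0" and u0: "u0 \<in> S" "a u0 > 0"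
    and T: "convex T"
    and L: "\<And>u. u \<in> S \<Longrightarrow> convex_on T (L u)"
    and summable: "\<And>v. v \<in> T \<Longrightarrow> (\<lambda>u. a u * exp (L u v)) summable_on S"
  shows "convex_on T (\<lambda>v. ln (\<Sum>\<^sub>\<infinity>u\<in>S. a u * exp (L u v)))"
proof (rule convex_onI)
  fix t :: real and v w :: 'v
  assume t: "0 < t" "t < 1" and v: "v \<in> T" and w: "w \<in> T"
  define Z where "Z v = (\<Sum>\<^sub>\<infinity>u\<in>S. a u * exp (L u v))" for v
  define z where "z = (1 - t) *\<^sub>R v + t *\<^sub>R w"
  \<comment> \<open>The intended bound on \<open>ln (Z z)\<close>; it is reached through
    \<open>Z z * exp (- c) \<le> 1\<close>.\<close>
  define c where "c = (1 - t) * ln (Z v) + t * ln (Z w)"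
  have z: "z \<in> T"
    unfolding z_def using T v w t by (simp add: convexD)
  have Z_pos: "Z y > 0" if "y \<in> T" for y
    unfolding Z_def using a u0 summable[OF that] by (intro infsum_pos[where u = u0]) auto
  have sum_const: "((\<lambda>u. a u * exp (L u y) * r) has_sum Z y * r) S" if "y \<in> T" for y r
    unfolding Z_def using summable[OF that] by (intro has_sum_cmult_left) simp
  \<comment> \<open>After division by \<open>exp c\<close> the exponent is at most a convex
    combination of \<open>L u v - ln (Z v)\<close> and \<open>L u w - ln (Z w)\<close>; convexity of
    \<open>exp\<close> then splits it into normalised summands.\<close>
  have le: "a u * exp (L u z) * exp (- c)
      \<le> a u * exp (L u v) * ((1 - t) / Z v) + a u * exp (L u w) * (t / Z w)"
    if u: "u \<in> S" for u
  proof -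
    have "L u z \<le> (1 - t) * L u v + t * L u w"
      unfolding z_def using convex_onD[OF L[OF u]] t v w by simp
    then have "exp (L u z - c)
        \<le> exp ((1 - t) *\<^sub>R (L u v - ln (Z v)) + t *\<^sub>R (L u w - ln (Z w)))"
      by (simp add: c_def algebra_simps)
    also have "\<dots> \<le> (1 - t) * exp (L u v - ln (Z v)) + t * exp (L u w - ln (Z w))"
      using convex_onD[OF exp_convex] t by simp
    also have "\<dots> = exp (L u v) * ((1 - t) / Z v) + exp (L u w) * (t / Z w)"
      using Z_pos[OF v] Z_pos[OF w] by (simp add: exp_diff mult.commute)
    finally have "a u * exp (L u z - c)
        \<le> a u * (exp (L u v) * ((1 - t) / Z v) + exp (L u w) * (t / Z w))"
      using a[OF u] by (rule mult_left_mono)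
    then show ?thesis
      by (simp add: exp_diff exp_minus field_simps)
  qed
  \<comment> \<open>Summed over \<open>S\<close>, each family of normalised summands has total 1,
    which leaves \<open>(1 - t) + t\<close>.\<close>
  have "Z z * exp (- c) \<le> Z v * ((1 - t) / Z v) + Z w * (t / Z w)"
    using has_sum_mono[OF sum_const[OF z] has_sum_add[OF sum_const[OF v] sum_const[OF w]] le] .
  also have "\<dots> = 1"
    using Z_pos[OF v] Z_pos[OF w] by simp
  finally have "Z z \<le> exp c"
    by (simp add: exp_minus field_simps)
  then have "ln (Z z) \<le> c"
    using Z_pos[OF z] by (metis exp_gt_zero ln_exp ln_le_cancel_iff)
  then show "ln (\<Sum>\<^sub>\<infinity>u\<in>S. a u * exp (L u ((1 - t) *\<^sub>R v + t *\<^sub>R w)))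
      \<le> (1 - t) * ln (\<Sum>\<^sub>\<infinity>u\<in>S. a u * exp (L u v)) + t * ln (\<Sum>\<^sub>\<infinity>u\<in>S. a u * exp (L u w))"
    by (simp add: Z_def z_def c_def)
qed (rule T)

lemma convex_on_sum_fun:
  fixes f :: "'i \<Rightarrow> 'a::real_vector \<Rightarrow> real"
  assumes "\<And>i. i \<in> I \<Longrightarrow> convex_on T (f i)" and "convex T"
  shows "convex_on T (\<lambda>v. \<Sum>i\<in>I. f i v)"
  using assms
  by (induction I rule: infinite_finite_induct)
    (auto intro!: convex_on_add simp: convex_on_const)

lemma p_bar_nonneg: "p_bar m k x u \<ge> 0"
  by (simp add: p_bar_def exp_neg_def)

lemma next_exp_uminus: "next_exp m k x u (\<lambda>y. - f y) = - next_exp m k x u f"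
  by (simp add: next_exp_def)

text \<open>An expectation that does not exist has the default value 0, so additivity in
  \<open>v\<close> rests on integrability. The inner product is a finite sum over components and
  inherits it from them.\<close>

lemma linear_next_exp_inner:
  fixes h :: "'x \<Rightarrow> real ^ 'f"
  assumes "\<And>i. integrable (measure_pmf (trans_p m k u x)) (\<lambda>y. h y $ i)"
  shows "linear (\<lambda>v. next_exp m k x u (\<lambda>y. v \<bullet> h y))"
proof -
  have int: "integrable (measure_pmf (trans_p m k u x)) (\<lambda>y. v \<bullet> h y)" for v
    using assms by (simp add: inner_vec_def)
  show ?thesis
    by (rule linearI) (simp_all add: next_exp_def inner_add_left int)
qed

text \<open>For \<open>c > 0\<close> the map from \<open>y\<close> to \<open>c * exp (- y)\<close>
  is strictly decreasing, so it reverses all comparisons.\<close>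

lemma is_arg_max_iff_is_arg_min:
  fixes f g :: "'a \<Rightarrow> real"
  assumes "\<And>w. f w = c * exp (- g w)" and "c > 0"
  shows "is_arg_max f P w \<longleftrightarrow> is_arg_min g P w"
  using assms by (simp add: is_arg_max_linorder is_arg_min_linorder)

theorem theorem2:
  fixes m :: "(int ^ 'n, int ^ 'p) control_problem"
    and h :: "int ^ 'n \<Rightarrow> real ^ 'f"
    and M :: nat
    and slot :: "nat \<Rightarrow> 'm::finite"
    and pstar :: "(int ^ 'n, int ^ 'p) policy"
    and xd :: "nat \<Rightarrow> int ^ 'n"
    and ud :: "nat \<Rightarrow> int ^ 'p"
  assumes "wf_problem m"
    and "recursion_exists m"
    and "M \<le> horizon m"
    and "bij_betw slot {1..M} UNIV"
    and "optimal_policy m pstar"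
    and "\<bar>total_cost m pstar\<bar> \<noteq> \<infinity>"
    and "\<forall>k\<in>{1..M}. \<forall>x\<in>States m. \<forall>u\<in>Inputs m.
           pmf (pstar k x) u = policy_formula m k (c_bar m k) x u"
    and "\<exists>w :: real ^ 'f ^ 'm. \<forall>k\<in>{1..M}. \<forall>x\<in>States m.
           c_bar m k x = - (w $ slot k \<bullet> h x)"
    and "xd 0 \<in> set_pmf (init_p m)"
    and "\<forall>k\<in>{1..M - 1}. xd k \<in> set_pmf (trans_p m k (ud k) (xd (k - 1)))"
    and "\<forall>k\<in>{1..M}. ud k \<in> set_pmf (pstar k (xd (k - 1)))"
    and "\<forall>k\<in>{1..M}. \<forall>u\<in>Inputs m. \<forall>i.
           integrable (measure_pmf (trans_p m k u (xd (k - 1)))) (\<lambda>x. h x $ i)"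
    and "\<forall>k\<in>{1..M}. \<forall>v :: real ^ 'f.
           (\<lambda>u. p_bar m k (xd (k - 1)) u * exp (next_exp m k (xd (k - 1)) u (\<lambda>x. v \<bullet> h x)))
             summable_on Inputs m"
  shows "convex_on UNIV (objective m h M slot xd ud) \<and>
    (\<forall>w. is_arg_max (likelihood m h M slot xd ud) (\<lambda>_. True) w \<longleftrightarrow>
         is_arg_min (objective m h M slot xd ud) (\<lambda>_. True) w) \<and>
    (\<forall>c. max_likelihood_estimate m h M slot xd ud c \<longleftrightarrow>
         (\<exists>w. is_arg_min (objective m h M slot xd ud) (\<lambda>_. True) w \<and>
              (\<forall>k\<in>{1..M}. \<forall>x\<in>States m. c k x = - (w $ slot k \<bullet> h x))))"
proof -
  let ?L = "\<lambda>k u w. next_exp m k (xd (k - 1)) u (\<lambda>x. w $ slot k \<bullet> h x)"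
  let ?Z = "\<lambda>k w. \<Sum>\<^sub>\<infinity>u\<in>Inputs m. p_bar m k (xd (k - 1)) u * exp (?L k u w)"
  have admissible: "set_pmf (pstar k x) \<subseteq> Inputs m" if "k \<in> {1..M}" "x \<in> States m" for k x
    using assms(3,5) that
    by (auto simp: optimal_policy_def is_arg_min_def admissible_policy_def)
  \<comment> \<open>The data never leave the carriers: the policy's support puts the next input in
    \<open>Inputs m\<close>, then well-formedness puts the next state in \<open>States m\<close>.
    The last recorded state has index \<open>M - 1\<close>.\<close>
  have x_mem: "xd k \<in> States m" if "k < M" for k
    using that
  proof (induction k)
    case 0
    then show ?case
      using assms(1,9) by (auto simp: wf_problem_def)
  next
    case (Suc k)
    then have k: "Suc k \<in> {1..M - 1}" "Suc k \<in> {1..M}" and x: "xd k \<in> States m"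
      by auto
    have "ud (Suc k) \<in> Inputs m"
      using admissible[OF k(2) x] assms(11) k(2) by fastforce
    moreover have "xd (Suc k) \<in> set_pmf (trans_p m (Suc k) (ud (Suc k)) (xd k))"
      using assms(10) k(1) by fastforce
    moreover have "Suc k \<in> {1..horizon m}"
      using k(2) assms(3) by auto
    ultimately show ?case
      using assms(1) x unfolding wf_problem_def by blast
  qed
  have x_mem': "xd (k - 1) \<in> States m" if "k \<in> {1..M}" for k
    using that by (intro x_mem) auto
  have u_mem: "ud k \<in> Inputs m" if "k \<in> {1..M}" for k
    using admissible[OF that x_mem'[OF that]] assms(11) that by blast
  have p_bar_pos: "p_bar m k (xd (k - 1)) (ud k) > 0" if k: "k \<in> {1..M}" for k
  proof -
    \<comment> \<open>The input was drawn from \<open>pstar\<close>, which is the closed form at the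
      true cost-to-go; a zero weight would make its numerator vanish.\<close>
    have "policy_formula m k (c_bar m k) (xd (k - 1)) (ud k) \<noteq> 0"
      using assms(7,11) k x_mem'[OF k] u_mem[OF k] by (metis set_pmf_iff)
    then have "p_bar m k (xd (k - 1)) (ud k) \<noteq> 0"
      by (auto simp: policy_formula_def)
    then show ?thesis
      using p_bar_nonneg[of m k "xd (k - 1)" "ud k"] by linarith
  qed
  have summable: "(\<lambda>u. p_bar m k (xd (k - 1)) u * exp (?L k u w)) summable_on Inputs m"
    if "k \<in> {1..M}" for k w
    using assms(13) that by blast
  \<comment> \<open>The visited input \<open>ud k\<close> supplies a positive summand, whatever
    \<open>w\<close> is.\<close>
  have Z_pos: "?Z k w > 0" if "k \<in> {1..M}" for k w
    using p_bar_pos[OF that] u_mem[OF that] summable[OF that]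
    by (intro infsum_pos[where u = "ud k"]) (auto simp: p_bar_nonneg)
  have linear_L: "linear (?L k u)" if "k \<in> {1..M}" "u \<in> Inputs m" for k u
  proof -
    \<comment> \<open>Selecting a block is linear, so linearity in one block lifts to the stacked
      parameter.\<close>
    have "linear (\<lambda>w :: real ^ 'f ^ 'm. w $ slot k)"
      by (rule linearI) simp_all
    moreover have "linear (\<lambda>v. next_exp m k (xd (k - 1)) u (\<lambda>x. v \<bullet> h x))"
      using assms(12) that by (intro linear_next_exp_inner) blast
    ultimately show ?thesis
      using linear_compose by (fastforce simp: o_def)
  qed

  \<comment> \<open>All factors free of \<open>w\<close>; they are positive because the data lie in
    the supports.\<close>
  define C where "C = pmf (init_p m) (xd 0) *
    (\<Prod>k=1..M - 1. pmf (trans_p m k (ud k) (xd (k - 1))) (xd k)) *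
    (\<Prod>k=1..M. p_bar m k (xd (k - 1)) (ud k))"
  have C_pos: "C > 0"
    unfolding C_def using assms(9,10) p_bar_pos
    by (intro mult_pos_pos prod_pos) (auto simp: pmf_positive)
  have likelihood: "likelihood m h M slot xd ud w = C * exp (- objective m h M slot xd ud w)" for w
  proof -
    \<comment> \<open>The sign of the cost-to-go cancels the one in the policy's exponent, and
      division by \<open>?Z k w\<close> becomes \<open>exp (- ln (?Z k w))\<close> by
      positivity.\<close>
    have "policy_formula m k (\<lambda>x. - (w $ slot k \<bullet> h x)) (xd (k - 1)) (ud k)
        = p_bar m k (xd (k - 1)) (ud k) * exp (- (- ?L k (ud k) w + ln (?Z k w)))"
      if "k \<in> {1..M}" for k
      using Z_pos[OF that, of w] by (simp add: policy_formula_def next_exp_uminus exp_diff)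
    then have "(\<Prod>k=1..M. policy_formula m k (\<lambda>x. - (w $ slot k \<bullet> h x)) (xd (k - 1)) (ud k))
        = (\<Prod>k=1..M. p_bar m k (xd (k - 1)) (ud k)) * exp (- objective m h M slot xd ud w)"
      by (simp add: objective_def sum_negf[symmetric] exp_sum prod.distrib del: minus_add_distrib)
    then show ?thesis
      by (simp add: likelihood_def C_def)
  qed
  have arg: "is_arg_max (likelihood m h M slot xd ud) (\<lambda>_. True) w \<longleftrightarrow>
      is_arg_min (objective m h M slot xd ud) (\<lambda>_. True) w" for w
    by (rule is_arg_max_iff_is_arg_min[OF likelihood C_pos])
  \<comment> \<open>Each time contributes a linear term plus a log-sum-exp of linear functions, with
    \<open>ud k\<close> as the index of positive weight.\<close>
  have "convex_on UNIV (\<lambda>w. - ?L k (ud k) w + ln (?Z k w))" if k: "k \<in> {1..M}" for k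
  proof (rule convex_on_add)
    show "convex_on UNIV (\<lambda>w. - ?L k (ud k) w)"
      using linear_L[OF k u_mem[OF k]]
      by (intro linear_imp_convex_on linear_compose_neg) simp_all
    show "convex_on UNIV (\<lambda>w. ln (?Z k w))"
      using p_bar_pos[OF k] u_mem[OF k] summable[OF k] linear_L[OF k]
      by (intro convex_on_ln_infsum_exp[where ?u0.0 = "ud k"])
        (auto simp: p_bar_nonneg intro: linear_imp_convex_on)
  qed
  then have "convex_on UNIV (objective m h M slot xd ud)"
    unfolding objective_def by (intro convex_on_sum_fun) auto
  then show ?thesis
    by (simp add: arg max_likelihood_estimate_def)
qed

end
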